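(* Let $\alpha_1,\dots,\alpha_n$ be regular planar curves in $\mathbb{C}$, and let $s_j$ be the arclength parameter and $\kappa_j$ the curvature of $\alpha_j$, $1\le j\le n$. Then the product map $$\Phi(s_1,\dots,s_n)=(\alpha_1(s_1),\dots,\alpha_n(s_n))$$ is a flat Lagrangian immersion into $\mathbb{C}^n$ whose Lagrangian angle map is $$\beta_\Phi(s_1,\dots,s_n)=\sum_{j=1}^n\arg\alpha_j'(s_j).$$ In addition, denoting by $D$ the Levi-Civita connection of the induced metric, for each $1\le j\le n$ $$D_{\partial_{s_j}}\nabla\beta_\Phi=\frac{d\kappa_j}{ds_j}\,\partial_{s_j},\qquad\text{and}\qquad \Delta\beta_\Phi=\sum_{j=1}^n\frac{d\kappa_j}{ds_j}.$$
   Context: An immersion of an $n$-manifold into $\mathbb{C}^n$ is Lagrangian if it pulls back the standard symplectic form $\omega=-\mathrm{Im}\sum_j z_j\bar w_j$ to $0$; it is flat if the induced metric is flat. The Lagrangian angle of an oriented Lagrangian immersion $\Phi$ is the $\mathbb{R}/2\pi\mathbb{Z}$-valued map $\beta_\Phi=\arg\,(dz_1\wedge\dots\wedge dz_n)(d\Phi(e_1),\dots,d\Phi(e_n))$ for any oriented tangent frame $(e_1,\dots,e_n)$; here the domain, a product of intervals, is oriented by $(\partial_{s_1},\dots,\partial_{s_n})$. For a non-vanishing complex function $f$, $\arg f\in\mathbb{R}/2\pi\mathbb{Z}$ is defined by $f=|f|e^{i\arg f}$. Gradient $\nabla$ and Laplacian $\Delta=\mathrm{div}\,\nabla$ are with respect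 to the induced metric and computed via local real-valued lifts. Curvature of planar curves is signed. *)

theory Defs
  imports "HOL-Analysis.Analysis"
begin

section \<open>Smooth maps\<close>

primrec Ck_on :: "nat \<Rightarrow> 'a::real_normed_vector set \<Rightarrow> ('a \<Rightarrow> 'b::real_normed_vector) \<Rightarrow> bool" where
  "Ck_on 0 S f \<longleftrightarrow> continuous_on S f"
| "Ck_on (Suc k) S f \<longleftrightarrow>
     (\<forall>x\<in>S. f differentiable (at x)) \<and> (\<forall>v. Ck_on k S (\<lambda>x. frechet_derivative f (at x) v))"

text \<open>Only meant for open sets \<open>S\<close>: the derivatives are taken in the ambient space.\<close>

definition smooth_on :: "'a::real_normed_vector set \<Rightarrow> ('a \<Rightarrow> 'b::real_normed_vector) \<Rightarrow> bool" where
  "smooth_on S f \<longleftrightarrow> (\<forall>k. Ck_on k S f)"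

section \<open>Angles, i.e. the group of reals modulo \<open>2\<pi>\<close>\<close>

quotient_type angle = real / "\<lambda>x y. \<exists>k::int. x - y = 2 * pi * of_int k"
  morphisms rep_angle angle_of
proof (rule equivpI)
  show "reflp (\<lambda>x y. \<exists>k::int. x - y = 2 * pi * of_int k)"
    by (rule reflpI) (rule exI[of _ 0], simp)
  show "symp (\<lambda>x y. \<exists>k::int. x - y = 2 * pi * of_int k)"
  proof (rule sympI)
    fix x y assume "\<exists>k::int. x - y = 2 * pi * of_int k"
    then obtain k :: int where "x - y = 2 * pi * of_int k" by blast
    then have "y - x = 2 * pi * of_int (- k)" by (simp add: algebra_simps)
    then show "\<exists>k::int. y - x = 2 * pi * of_int k" by blast
  qed
  show "transp (\<lambda>x y. \<exists>k::int. x - y = 2 * pi * of_int k)"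
  proof (rule transpI)
    fix x y z assume "\<exists>k::int. x - y = 2 * pi * of_int k" "\<exists>k::int. y - z = 2 * pi * of_int k"
    then obtain k l :: int where "x - y = 2 * pi * of_int k" "y - z = 2 * pi * of_int l" by blast
    then have "x - z = 2 * pi * of_int (k + l)" by (simp add: algebra_simps)
    then show "\<exists>k::int. x - z = 2 * pi * of_int k" by blast
  qed
qed

instantiation angle :: ab_group_add
begin

lift_definition zero_angle :: angle is 0 .

lift_definition plus_angle :: "angle \<Rightarrow> angle \<Rightarrow> angle" is "(+)"
proof -
  fix a b c d :: real
  assume "\<exists>k::int. a - b = 2 * pi * of_int k" "\<exists>k::int. c - d = 2 * pi * of_int k"
  then obtain k l :: int where "a - b = 2 * pi * of_int k" "c - d = 2 * pi * of_int l" by blast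
  then have "(a + c) - (b + d) = 2 * pi * of_int (k + l)" by (simp add: algebra_simps)
  then show "\<exists>k::int. (a + c) - (b + d) = 2 * pi * of_int k" by blast
qed

lift_definition uminus_angle :: "angle \<Rightarrow> angle" is uminus
proof -
  fix a b :: real
  assume "\<exists>k::int. a - b = 2 * pi * of_int k"
  then obtain k :: int where "a - b = 2 * pi * of_int k" by blast
  then have "- a - - b = 2 * pi * of_int (- k)" by (simp add: algebra_simps)
  then show "\<exists>k::int. - a - - b = 2 * pi * of_int k" by blast
qed

definition minus_angle :: "angle \<Rightarrow> angle \<Rightarrow> angle" where
  "minus_angle a b = a + (- b)"

instance
proof
  fix a b c :: angle
  show "a + b + c = a + (b + c)" by transfer (rule exI[of _ 0], simp)
  show "a + b = b + a" by transfer (rule exI[of _ 0], simp)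
  show "0 + a = a" by transfer (rule exI[of _ 0], simp)
  show "- a + a = 0" by transfer (rule exI[of _ 0], simp)
  show "a - b = a + - b" by (rule minus_angle_def)
qed

end

text \<open>\<open>Arg\<close> is the principal value; only its class modulo \<open>2\<pi>\<close> is kept.\<close>

definition carg :: "complex \<Rightarrow> angle" where
  "carg z = angle_of (Arg z)"

lemma angle_of_eq_iff: "angle_of x = angle_of y \<longleftrightarrow> (\<exists>k::int. x - y = 2 * pi * of_int k)"
  using angle.abs_eq_iff .

lemma angle_of_eq_iff_cis: "angle_of x = angle_of y \<longleftrightarrow> cis x = cis y"
proof -
  have "cis x = cis y \<longleftrightarrow> (\<exists>k::int. x = y + 2 * pi * of_int k)"
    using sin_cos_eq_iff[of x y] by (simp add: complex_eq_iff conj_commute)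
  then show ?thesis
    unfolding angle_of_eq_iff by (simp add: algebra_simps)
qed

lemma carg_eq_angle_of_iff:
  assumes "z \<noteq> 0"
  shows "carg z = angle_of \<theta> \<longleftrightarrow> z = of_real (cmod z) * exp (\<i> * of_real \<theta>)"
proof -
  have "carg z = angle_of \<theta> \<longleftrightarrow> sgn z = cis \<theta>"
    using assms by (simp add: carg_def angle_of_eq_iff_cis cis_Arg)
  also have "\<dots> \<longleftrightarrow> z = of_real (cmod z) * exp (\<i> * of_real \<theta>)"
    using assms by (auto simp: sgn_eq cis_conv_exp field_simps)
  finally show ?thesis .
qed

section \<open>Planar curves\<close>

abbreviation velocity :: "(real \<Rightarrow> complex) \<Rightarrow> real \<Rightarrow> complex" where
  "velocity \<gamma> t \<equiv> vector_derivative \<gamma> (at t)"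

definition regular_curve :: "real set \<Rightarrow> (real \<Rightarrow> complex) \<Rightarrow> bool" where
  "regular_curve J \<gamma> \<longleftrightarrow>
     open J \<and> is_interval J \<and> smooth_on J \<gamma> \<and> (\<forall>t\<in>J. velocity \<gamma> t \<noteq> 0)"

text \<open>
  \<open>\<alpha>\<close> on \<open>I\<close> is the curve \<open>\<gamma>\<close> on \<open>J\<close>, written in terms of an arclength parameter
  \<open>\<sigma>\<close> (which is determined up to an additive constant).
\<close>

definition arclength_parametrization ::
    "real set \<Rightarrow> (real \<Rightarrow> complex) \<Rightarrow> real set \<Rightarrow> (real \<Rightarrow> complex) \<Rightarrow> bool" where
  "arclength_parametrization J \<gamma> I \<alpha> \<longleftrightarrow>
     (\<exists>\<sigma>. (\<forall>a\<in>J. \<forall>b\<in>J. a \<le> b \<longrightarrow>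
             ((\<lambda>t. cmod (velocity \<gamma> t)) has_integral (\<sigma> b - \<sigma> a)) {a..b}) \<and>
          I = \<sigma> ` J \<and> (\<forall>t\<in>J. \<alpha> (\<sigma> t) = \<gamma> t))"

text \<open>Note that \<open>Im (cnj z * w)\<close> is the determinant of the real vectors \<open>z, w\<close>.\<close>

definition signed_curvature :: "(real \<Rightarrow> complex) \<Rightarrow> real \<Rightarrow> real" where
  "signed_curvature \<gamma> t =
     Im (cnj (velocity \<gamma> t) * velocity (velocity \<gamma>) t) / cmod (velocity \<gamma> t) ^ 3"

section \<open>Riemannian metrics in coordinates\<close>

text \<open>
  A metric on an open subset of \<open>real^'n\<close> is given by its Gram matrix \<open>g x\<close> in the
  coordinate frame; a vector field is given by its components in that frame.
\<close>

type_synonym 'n metric = "real^'n \<Rightarrow> real^'n^'n"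

text \<open>
  \<open>christoffel g x k i j = 1/2 g^{kl} (d_i g_{jl} + d_j g_{il} - d_l g_{ij})\<close>, summed over \<open>l\<close>.
\<close>

definition christoffel :: "'n::finite metric \<Rightarrow> real^'n \<Rightarrow> 'n \<Rightarrow> 'n \<Rightarrow> 'n \<Rightarrow> real" where
  "christoffel g x k i j =
     (\<Sum>l\<in>UNIV. matrix_inv (g x) $ k $ l *
        (frechet_derivative g (at x) (axis i 1) $ j $ l
         + frechet_derivative g (at x) (axis j 1) $ i $ l
         - frechet_derivative g (at x) (axis l 1) $ i $ j)) / 2"

text \<open>The derivative of the field \<open>Y\<close> in the direction of the tangent vector \<open>v\<close> at \<open>x\<close>.\<close>

definition levi_civita ::
    "'n::finite metric \<Rightarrow> real^'n \<Rightarrow> (real^'n \<Rightarrow> real^'n) \<Rightarrow> real^'n \<Rightarrow> real^'n" where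
  "levi_civita g v Y x =
     frechet_derivative Y (at x) v
     + (\<chi> k. \<Sum>i\<in>UNIV. \<Sum>j\<in>UNIV. christoffel g x k i j * v $ i * Y x $ j)"

text \<open>
  \<open>R(u,v)w\<close>, obtained by extending \<open>u, v, w\<close> to fields with constant components; the Lie
  bracket of the extensions vanishes.
\<close>

definition riemann_curvature ::
    "'n::finite metric \<Rightarrow> real^'n \<Rightarrow> real^'n \<Rightarrow> real^'n \<Rightarrow> real^'n \<Rightarrow> real^'n" where
  "riemann_curvature g u v w x =
     levi_civita g u (levi_civita g v (\<lambda>_. w)) x - levi_civita g v (levi_civita g u (\<lambda>_. w)) x"

definition flat_metric_on :: "(real^'n) set \<Rightarrow> 'n::finite metric \<Rightarrow> bool" where
  "flat_metric_on U g \<longleftrightarrow> (\<forall>x\<in>U. \<forall>u v w. riemann_curvature g u v w x = 0)"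

definition gradient :: "'n::finite metric \<Rightarrow> (real^'n \<Rightarrow> real) \<Rightarrow> real^'n \<Rightarrow> real^'n" where
  "gradient g h x = matrix_inv (g x) *v (\<chi> i. frechet_derivative h (at x) (axis i 1))"

definition divergence :: "'n::finite metric \<Rightarrow> (real^'n \<Rightarrow> real^'n) \<Rightarrow> real^'n \<Rightarrow> real" where
  "divergence g Y x = (\<Sum>i\<in>UNIV. levi_civita g (axis i 1) Y x $ i)"

lemma matrix_inv_mul:
  fixes A :: "real^'n^'n"
  assumes "invertible A"
  shows "A ** matrix_inv A = mat 1" "matrix_inv A ** A = mat 1"
  using someI_ex[OF assms[unfolded invertible_def]] unfolding matrix_inv_def by auto

lemma inner_gradient:
  assumes "h differentiable (at x)" "invertible (g x)"
  shows "v \<bullet> (g x *v gradient g h x) = frechet_derivative h (at x) v"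
proof -
  have lin: "linear (frechet_derivative h (at x))"
    using assms(1) by (rule linear_frechet_derivative)
  have "g x *v gradient g h x = (\<chi> i. frechet_derivative h (at x) (axis i 1))"
    using assms(2) by (simp add: gradient_def matrix_vector_mul_assoc matrix_inv_mul)
  then have "v \<bullet> (g x *v gradient g h x) = (\<Sum>i\<in>UNIV. v $ i * frechet_derivative h (at x) (axis i 1))"
    by (simp add: inner_vec_def)
  also have "\<dots> = frechet_derivative h (at x) (\<Sum>i\<in>UNIV. v $ i *\<^sub>R axis i 1)"
    using lin by (simp add: linear_sum linear_cmul)
  also have "(\<Sum>i\<in>UNIV. v $ i *\<^sub>R axis i 1) = v"
    using basis_expansion[of v] by (simp add: scalar_mult_eq_scaleR)
  finally show ?thesis .
qed

text \<open>\<open>levi_civita\<close> is torsion-free and compatible with the metric.\<close>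

lemma frechet_derivative_symmetric:
  assumes "g differentiable (at x)" "\<And>y. transpose (g y) = g y"
  shows "frechet_derivative g (at x) v $ i $ j = frechet_derivative g (at x) v $ j $ i"
proof -
  let ?G = "frechet_derivative g (at x)"
  have G: "(g has_derivative ?G) (at x)"
    using assms(1) by (simp add: frechet_derivative_works)
  have nth: "((\<lambda>y. g y $ i $ j) has_derivative (\<lambda>v. ?G v $ i $ j)) (at x)" for i j
    by (intro bounded_linear.has_derivative[OF bounded_linear_vec_nth] G)
  have "g y $ i $ j = g y $ j $ i" for y
    by (subst assms(2)[of y, symmetric]) (simp add: transpose_def)
  then have "((\<lambda>y. g y $ i $ j) has_derivative (\<lambda>v. ?G v $ j $ i)) (at x)"
    using nth[of j i] by simp
  then have "(\<lambda>v. ?G v $ i $ j) = (\<lambda>v. ?G v $ j $ i)"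
    by (rule has_derivative_unique[OF nth[of i j]])
  then show ?thesis by (rule fun_cong)
qed

lemma levi_civita_torsion_free:
  assumes "g differentiable (at x)" "\<And>y. transpose (g y) = g y"
  shows "levi_civita g (X x) Y x - levi_civita g (Y x) X x =
           frechet_derivative Y (at x) (X x) - frechet_derivative X (at x) (Y x)"
proof -
  have sym: "christoffel g x k i j = christoffel g x k j i" for k i j
    using frechet_derivative_symmetric[OF assms] by (simp add: christoffel_def add.commute)
  have "(\<Sum>i\<in>UNIV. \<Sum>j\<in>UNIV. christoffel g x k i j * X x $ i * Y x $ j) =
        (\<Sum>i\<in>UNIV. \<Sum>j\<in>UNIV. christoffel g x k i j * Y x $ i * X x $ j)" for k
    by (subst sum.swap) (simp add: sym[of k] mult.commute mult.left_commute)
  then show ?thesis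
    by (simp add: levi_civita_def)
qed

lemma levi_civita_metric:
  assumes g: "g differentiable (at x)" "\<And>y. transpose (g y) = g y" "invertible (g x)"
    and YZ: "Y differentiable (at x)" "Z differentiable (at x)"
  shows "frechet_derivative (\<lambda>y. Y y \<bullet> (g y *v Z y)) (at x) v =
           levi_civita g v Y x \<bullet> (g x *v Z x) + Y x \<bullet> (g x *v levi_civita g v Z x)"
proof -
  let ?G = "frechet_derivative g (at x)"
    and ?Y = "frechet_derivative Y (at x)" and ?Z = "frechet_derivative Z (at x)"
  define d where "d i j l = ?G (axis i 1) $ j $ l" for i j l
  define C where "C W = (\<chi> k. \<Sum>i\<in>UNIV. \<Sum>j\<in>UNIV. christoffel g x k i j * v $ i * W $ j)" for W :: "real^'a"
  have gsym: "g y $ i $ j = g y $ j $ i" for y i j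
    by (subst g(2)[of y, symmetric]) (simp add: transpose_def)
  have dsym: "d i j l = d i l j" for i j l
    unfolding d_def using frechet_derivative_symmetric[OF g(1,2)] .
  have G: "(g has_derivative ?G) (at x)" and Y: "(Y has_derivative ?Y) (at x)"
    and Z: "(Z has_derivative ?Z) (at x)"
    using g(1) YZ by (simp_all add: frechet_derivative_works)
  have Gv: "?G v $ j $ l = (\<Sum>i\<in>UNIV. v $ i * d i j l)" for j l
  proof -
    have "?G v = ?G (\<Sum>i\<in>UNIV. v $ i *\<^sub>R axis i 1)"
      using basis_expansion[of v] by (simp add: scalar_mult_eq_scaleR)
    also have "\<dots> = (\<Sum>i\<in>UNIV. v $ i *\<^sub>R ?G (axis i 1))"
      using linear_frechet_derivative[OF g(1)] by (simp add: linear_sum linear_cmul)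
    finally show ?thesis by (simp add: d_def)
  qed
  have nth: "((\<lambda>y. Y y $ i) has_derivative (\<lambda>v. ?Y v $ i)) (at x)"
    "((\<lambda>y. Z y $ i) has_derivative (\<lambda>v. ?Z v $ i)) (at x)"
    "((\<lambda>y. g y $ i $ j) has_derivative (\<lambda>v. ?G v $ i $ j)) (at x)" for i j
    by (intro bounded_linear.has_derivative[OF bounded_linear_vec_nth] G Y Z)+
  have expand: "a \<bullet> (A *v b) = (\<Sum>i\<in>UNIV. \<Sum>j\<in>UNIV. a $ i * (A $ i $ j * b $ j))"
    for a b :: "real^'a" and A :: "real^'a^'a"
    by (simp add: inner_vec_def matrix_vector_mult_def sum_distrib_left)
  have D: "((\<lambda>y. Y y \<bullet> (g y *v Z y)) has_derivative
      (\<lambda>v. ?Y v \<bullet> (g x *v Z x) + Y x \<bullet> (?G v *v Z x) + Y x \<bullet> (g x *v ?Z v))) (at x)"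
    unfolding expand
    by (rule derivative_eq_intros nth refl | simp)+
       (simp add: fun_eq_iff sum.distrib[symmetric] algebra_simps)
  have low: "(g x *v C W) $ m =
      (\<Sum>i\<in>UNIV. \<Sum>j\<in>UNIV. v $ i * W $ j * ((d i j m + d j i m - d m i j) / 2))" for W m
  proof -
    define E where "E i j = (\<chi> l. (d i j l + d j i l - d l i j) / 2)" for i j
    have chr: "christoffel g x k i j = (matrix_inv (g x) *v E i j) $ k" for k i j
      by (simp add: christoffel_def matrix_vector_mult_def E_def d_def sum_divide_distrib)
    have "C W = (\<Sum>i\<in>UNIV. \<Sum>j\<in>UNIV. (v $ i * W $ j) *\<^sub>R (matrix_inv (g x) *v E i j))"
      by (simp add: C_def vec_eq_iff chr mult_ac)
    then have "g x *v C W = (\<Sum>i\<in>UNIV. \<Sum>j\<in>UNIV. (v $ i * W $ j) *\<^sub>R (g x *v (matrix_inv (g x) *v E i j)))"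
      by (simp add: matrix_vector_mul_linear linear_sum linear_cmul)
    also have "\<dots> = (\<Sum>i\<in>UNIV. \<Sum>j\<in>UNIV. (v $ i * W $ j) *\<^sub>R E i j)"
      using g(3) by (simp add: matrix_vector_mul_assoc matrix_inv_mul)
    finally show ?thesis by (simp add: E_def)
  qed
  have swap: "a \<bullet> (g x *v b) = b \<bullet> (g x *v a)" for a b
    unfolding expand by (subst sum.swap) (simp add: gsym mult_ac)
  have pair: "a \<bullet> (g x *v C W) =
      (\<Sum>i\<in>UNIV. \<Sum>j\<in>UNIV. \<Sum>m\<in>UNIV. v $ i * W $ j * a $ m * ((d i j m + d j i m - d m i j) / 2))" for a W
  proof -
    have "a \<bullet> (g x *v C W) =
      (\<Sum>m\<in>UNIV. \<Sum>i\<in>UNIV. \<Sum>j\<in>UNIV. v $ i * W $ j * a $ m * ((d i j m + d j i m - d m i j) / 2))"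
      by (simp add: inner_vec_def low sum_distrib_left mult_ac)
    also have "\<dots> = (\<Sum>i\<in>UNIV. \<Sum>m\<in>UNIV. \<Sum>j\<in>UNIV. v $ i * W $ j * a $ m * ((d i j m + d j i m - d m i j) / 2))"
      by (rule sum.swap)
    also have "\<dots> = (\<Sum>i\<in>UNIV. \<Sum>j\<in>UNIV. \<Sum>m\<in>UNIV. v $ i * W $ j * a $ m * ((d i j m + d j i m - d m i j) / 2))"
      by (intro sum.cong refl sum.swap)
    finally show ?thesis .
  qed
  have "C (Y x) \<bullet> (g x *v Z x) = (\<Sum>i\<in>UNIV. \<Sum>j\<in>UNIV. \<Sum>m\<in>UNIV.
      v $ i * Y x $ j * Z x $ m * ((d i j m + d j i m - d m i j) / 2))"
    by (subst swap) (rule pair)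
  also have "\<dots> = (\<Sum>i\<in>UNIV. \<Sum>j\<in>UNIV. \<Sum>m\<in>UNIV.
      v $ i * Y x $ m * Z x $ j * ((d i m j + d m i j - d j i m) / 2))"
    by (intro sum.cong refl sum.swap)
  finally have CY: "C (Y x) \<bullet> (g x *v Z x) = (\<Sum>i\<in>UNIV. \<Sum>j\<in>UNIV. \<Sum>m\<in>UNIV.
      v $ i * Y x $ m * Z x $ j * ((d i m j + d m i j - d j i m) / 2))" .
  have "C (Y x) \<bullet> (g x *v Z x) + Y x \<bullet> (g x *v C (Z x)) =
      (\<Sum>i\<in>UNIV. \<Sum>j\<in>UNIV. \<Sum>m\<in>UNIV. v $ i * Y x $ m * Z x $ j * d i m j)"
    unfolding CY pair sum.distrib[symmetric]
    by (intro sum.cong refl) (simp add: field_simps dsym)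
  also have "\<dots> = (\<Sum>m\<in>UNIV. \<Sum>j\<in>UNIV. \<Sum>i\<in>UNIV. v $ i * Y x $ m * Z x $ j * d i m j)"
    by (subst sum.swap, subst (2) sum.swap, subst sum.swap, simp)
  also have "\<dots> = Y x \<bullet> (?G v *v Z x)"
    unfolding expand Gv by (simp add: sum_distrib_left sum_distrib_right mult_ac)
  finally have key: "C (Y x) \<bullet> (g x *v Z x) + Y x \<bullet> (g x *v C (Z x)) = Y x \<bullet> (?G v *v Z x)" .
  have lc: "levi_civita g v Y x = ?Y v + C (Y x)" "levi_civita g v Z x = ?Z v + C (Z x)"
    by (simp_all add: levi_civita_def C_def)
  show ?thesis
    unfolding frechet_derivative_at[OF D, symmetric] lc
    using key by (simp add: inner_add_left inner_add_right matrix_vector_right_distrib)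
qed

section \<open>Functions with values in angles\<close>

definition local_lift :: "(real^'n::finite \<Rightarrow> angle) \<Rightarrow> (real^'n \<Rightarrow> real) \<Rightarrow> real^'n \<Rightarrow> bool" where
  "local_lift f h x \<longleftrightarrow>
     (\<exists>W. open W \<and> x \<in> W \<and> smooth_on W h \<and> (\<forall>y\<in>W. f y = angle_of (h y)))"

definition angle_gradient ::
    "'n::finite metric \<Rightarrow> (real^'n \<Rightarrow> angle) \<Rightarrow> real^'n \<Rightarrow> real^'n" where
  "angle_gradient g f x = gradient g (SOME h. local_lift f h x) x"

definition angle_laplacian :: "'n::finite metric \<Rightarrow> (real^'n \<Rightarrow> angle) \<Rightarrow> real^'n \<Rightarrow> real" where
  "angle_laplacian g f x = divergence g (angle_gradient g f) x"

lemma angle_gradient_eq: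
  assumes "local_lift f h x"
  shows "angle_gradient g f x = gradient g h x"
proof -
  define h' where "h' = (SOME h. local_lift f h x)"
  have "local_lift f h' x" unfolding h'_def by (rule someI[of "\<lambda>h. local_lift f h x", OF assms])
  then obtain W' where W': "open W'" "x \<in> W'" "smooth_on W' h'" "\<And>y. y \<in> W' \<Longrightarrow> f y = angle_of (h' y)"
    unfolding local_lift_def by blast
  obtain W where W: "open W" "x \<in> W" "smooth_on W h" "\<And>y. y \<in> W \<Longrightarrow> f y = angle_of (h y)"
    using assms unfolding local_lift_def by blast
  have c: "continuous_on W h" "continuous_on W' h'" and d: "h differentiable (at x)"
    using W W' unfolding smooth_on_def by (metis Ck_on.simps(1), metis Ck_on.simps(1), metis Ck_on.simps(2))
  have "isCont (\<lambda>y. h' y - h y) x"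
    using c W W' by (intro continuous_intros) (auto simp: continuous_on_eq_continuous_at)
  then have "\<forall>\<^sub>F y in nhds x. dist (h' y - h y) (h' x - h x) < 2 * pi"
    using tendstoD[of "\<lambda>y. h' y - h y" "h' x - h x" "nhds x" "2 * pi"]
      tendsto_at_iff_tendsto_nhds[of "\<lambda>y. h' y - h y" x]
    by (simp add: isCont_def)
  moreover have "\<forall>\<^sub>F y in nhds x. y \<in> W \<inter> W'"
    using W W' by (intro eventually_nhds_in_open) auto
  ultimately have ev: "\<forall>\<^sub>F y in nhds x. h' y = h y + (h' x - h x)"
  proof eventually_elim
    case (elim y)
    have "angle_of (h' y) = angle_of (h y)" "angle_of (h' x) = angle_of (h x)"
      using elim(2) W W' by (metis IntD1 IntD2)+
    then obtain k l :: int where "h' y - h y = 2 * pi * of_int k" "h' x - h x = 2 * pi * of_int l"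
      unfolding angle_of_eq_iff by blast
    moreover from this elim(1) have "2 * pi * \<bar>of_int (k - l)\<bar> < 2 * pi * 1"
      by (simp add: dist_real_def right_diff_distrib[symmetric] abs_mult)
    then have "\<bar>of_int (k - l) :: real\<bar> < 1"
      by (simp del: of_int_diff)
    then have "k = l" by linarith
    ultimately show ?case by simp
  qed
  then obtain V where V: "open V" "x \<in> V" "\<And>y. y \<in> V \<Longrightarrow> h' y = h y + (h' x - h x)"
    unfolding eventually_nhds by blast
  have "(h has_derivative frechet_derivative h (at x)) (at x)"
    using d by (simp add: frechet_derivative_works)
  then have "((\<lambda>y. h y + (h' x - h x)) has_derivative frechet_derivative h (at x)) (at x)"
    by (auto intro!: derivative_eq_intros)
  then have "(h' has_derivative frechet_derivative h (at x)) (at x)"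
    by (rule has_derivative_transform_within_open[OF _ V(1,2)]) (simp add: V(3))
  then have "frechet_derivative h' (at x) = frechet_derivative h (at x)"
    by (rule frechet_derivative_at[symmetric])
  then show ?thesis
    by (simp add: angle_gradient_def h'_def gradient_def)
qed

section \<open>Lagrangian immersions into complex space\<close>

definition kaehler_form :: "complex^'n::finite \<Rightarrow> complex^'n \<Rightarrow> real" where
  "kaehler_form z w = - Im (\<Sum>j\<in>UNIV. z $ j * cnj (w $ j))"

definition immersion_on :: "(real^'n::finite) set \<Rightarrow> (real^'n \<Rightarrow> complex^'n) \<Rightarrow> bool" where
  "immersion_on U \<Phi> \<longleftrightarrow>
     open U \<and> smooth_on U \<Phi> \<and> (\<forall>x\<in>U. inj (frechet_derivative \<Phi> (at x)))"

definition lagrangian_immersion_on :: "(real^'n::finite) set \<Rightarrow> (real^'n \<Rightarrow> complex^'n) \<Rightarrow> bool" where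
  "lagrangian_immersion_on U \<Phi> \<longleftrightarrow> immersion_on U \<Phi> \<and>
     (\<forall>x\<in>U. \<forall>u v. kaehler_form (frechet_derivative \<Phi> (at x) u) (frechet_derivative \<Phi> (at x) v) = 0)"

text \<open>The real inner product on \<open>complex^'n\<close> is the Euclidean metric, i.e. the real part of the
  Hermitian product.\<close>

definition induced_metric :: "(real^'n::finite \<Rightarrow> complex^'n) \<Rightarrow> 'n metric" where
  "induced_metric \<Phi> x =
     (\<chi> i j. frechet_derivative \<Phi> (at x) (axis i 1) \<bullet> frechet_derivative \<Phi> (at x) (axis j 1))"

text \<open>
  \<open>dz_1 \<and> \<dots> \<and> dz_n\<close> evaluated on \<open>n\<close> vectors. The vectors and the coordinates carry the same
  index type, so that no ordering of the indices needs to be fixed.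
\<close>

definition dz_volume :: "('n \<Rightarrow> complex^'n) \<Rightarrow> complex" where
  "dz_volume w = det (\<chi> k j. w k $ j)"

text \<open>
  The angle is computed in the coordinate frame, which defines the orientation; by the lemma
  below every positively oriented frame gives the same result.
\<close>

definition lagrangian_angle :: "(real^'n::finite \<Rightarrow> complex^'n) \<Rightarrow> real^'n \<Rightarrow> angle" where
  "lagrangian_angle \<Phi> x = carg (dz_volume (\<lambda>k. frechet_derivative \<Phi> (at x) (axis k 1)))"

lemma carg_mult_pos:
  assumes "0 < r"
  shows "carg (of_real r * z) = carg z"
  using assms by (simp add: carg_def Arg_times_of_real)

lemma det_of_real: "det ((\<chi> i j. of_real (E $ i $ j)) :: complex^'n^'n) = of_real (det (E :: real^'n^'n))"
  by (simp add: det_def)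

lemma lagrangian_angle_frame:
  fixes e :: "'n::finite \<Rightarrow> real^'n"
  assumes "\<Phi> differentiable (at x)" "0 < det (\<chi> k i. e k $ i)"
  shows "carg (dz_volume (\<lambda>k. frechet_derivative \<Phi> (at x) (e k))) = lagrangian_angle \<Phi> x"
proof -
  let ?D = "frechet_derivative \<Phi> (at x)"
  have "?D (e k) = (\<Sum>i\<in>UNIV. e k $ i *\<^sub>R ?D (axis i 1))" for k
  proof -
    have "?D (e k) = ?D (\<Sum>i\<in>UNIV. e k $ i *\<^sub>R axis i 1)"
      using basis_expansion[of "e k"] by (simp add: scalar_mult_eq_scaleR)
    then show ?thesis
      using linear_frechet_derivative[OF assms(1)] by (simp add: linear_sum linear_cmul)
  qed
  then have "(\<chi> k j. ?D (e k) $ j) =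
      (\<chi> k i. of_real ((\<chi> k i. e k $ i) $ k $ i)) ** (\<chi> i j. ?D (axis i 1) $ j)"
    by (simp add: vec_eq_iff matrix_matrix_mult_def scaleR_conv_of_real[where 'a = complex])
  then have "dz_volume (\<lambda>k. ?D (e k)) =
      of_real (det (\<chi> k i. e k $ i)) * dz_volume (\<lambda>i. ?D (axis i 1))"
    by (simp only: dz_volume_def det_mul det_of_real)
  then show ?thesis
    using assms(2) by (simp add: lagrangian_angle_def carg_mult_pos)
qed

end

theory Submission
  imports Defs
begin

text \<open>
  In arclength parameters each factor satisfies \<open>\<bar>\<alpha>\<^sub>j'\<bar> = 1\<close>, and the differential of the product map
  is the diagonal matrix of the velocities \<open>\<alpha>\<^sub>j'(s\<^sub>j)\<close>.  Everything follows from this shape.  It is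
  Lagrangian because a curve in \<open>\<complex>\<close> is (\<open>lagrangian_immersion\<close>).  The frame \<open>\<partial>\<^sub>s\<^sub>j\<close> is sent to an
  orthonormal frame, so the induced metric is the Euclidean one: it is flat, and covariant
  derivatives are ordinary componentwise derivatives (\<open>induced_metric_\<Phi>\<close>,
  \<open>levi_civita_constant_metric\<close>).  The complex determinant is \<open>\<Prod>\<^sub>j \<alpha>\<^sub>j'\<close>, whose argument is the sum of
  the arguments (\<open>lagrangian_angle_\<Phi>\<close>).

  The angle \<open>\<theta>\<^sub>j\<close> of a unit speed curve has derivative \<open>\<kappa>\<^sub>j\<close> (\<open>local_angle_function\<close>).  So
  \<open>\<Sum>\<^sub>j \<theta>\<^sub>j(s\<^sub>j)\<close> is a local lift of the Lagrangian angle, the gradient is \<open>(\<kappa>\<^sub>j(s\<^sub>j))\<^sub>j\<close>, and one more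
  derivative gives \<open>\<kappa>\<^sub>j'\<close> on the diagonal and zero elsewhere (\<open>angle_gradient_\<Phi>\<close>,
  \<open>levi_civita_angle_gradient\<close>); the Laplacian is the trace.

  What remains is analysis: the arclength parametrization of a smooth regular curve is smooth, on
  an open domain (\<open>arclength_parametrization_unit_speed\<close>).  The smoothness proofs share one principle:
  when the derivative of every member of a family is built from members of the family and from
  smooth functions, induction on the number of derivatives shows that all members are smooth.  It
  is applied to products, to the inverse of the speed, and to the composition with the inverse of
  arclength.
\<close>

section \<open>Calculus of smooth maps\<close>

lemma Ck_on_cong:
  assumes "open S" "\<And>x. x \<in> S \<Longrightarrow> f x = g x"
  shows "Ck_on k S f \<longleftrightarrow> Ck_on k S g"
proof -
  have *: "Ck_on k S g" if "Ck_on k S f" "\<And>x. x \<in> S \<Longrightarrow> f x = g x" for f g :: "'a \<Rightarrow> 'b"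
    using that
  proof (induction k arbitrary: f g)
    case 0
    then show ?case by (auto cong: continuous_on_cong)
  next
    case (Suc k)
    have D: "(f has_derivative frechet_derivative f (at x)) (at x)" if "x \<in> S" for x
      using Suc.prems(1) that by (simp add: frechet_derivative_works)
    have D': "(g has_derivative frechet_derivative f (at x)) (at x)" if "x \<in> S" for x
      using has_derivative_transform_within_open[OF D[OF that] assms(1) that] Suc.prems(2) by blast
    show ?case
      unfolding Ck_on.simps
    proof (intro conjI ballI allI)
      show "g differentiable (at x)" if "x \<in> S" for x
        using D'[OF that] by (auto simp: differentiable_def)
      show "Ck_on k S (\<lambda>x. frechet_derivative g (at x) v)" for v
      proof (rule Suc.IH)
        show "Ck_on k S (\<lambda>x. frechet_derivative f (at x) v)"
          using Suc.prems(1) by simp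
        show "frechet_derivative f (at x) v = frechet_derivative g (at x) v" if "x \<in> S" for x
          using frechet_derivative_at[OF D'[OF that]] by simp
      qed
    qed
  qed
  show ?thesis
    using *[of f g] *[of g f] assms(2) by auto
qed

lemma Ck_on_SucI:
  assumes "open S" "\<And>x. x \<in> S \<Longrightarrow> (f has_derivative f' x) (at x)"
    and "\<And>v. Ck_on k S (\<lambda>x. f' x v)"
  shows "Ck_on (Suc k) S f"
  unfolding Ck_on.simps
proof (intro conjI ballI allI)
  show "f differentiable (at x)" if "x \<in> S" for x
    using assms(2)[OF that] by (auto simp: differentiable_def)
  have "frechet_derivative f (at x) v = f' x v" if "x \<in> S" for x v
    using frechet_derivative_at[OF assms(2)[OF that]] by simp
  then show "Ck_on k S (\<lambda>x. frechet_derivative f (at x) v)" for v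
    using Ck_on_cong[OF assms(1), of "\<lambda>x. frechet_derivative f (at x) v" "\<lambda>x. f' x v" k] assms(3)
    by blast
qed

lemma Ck_on_SucD:
  assumes "Ck_on (Suc k) S f" "x \<in> S"
  shows "(f has_derivative frechet_derivative f (at x)) (at x)"
  using assms by (simp add: frechet_derivative_works)

lemma Ck_on_antimono_Suc: "Ck_on (Suc k) S f \<Longrightarrow> Ck_on k S f"
proof (induction k arbitrary: f)
  case 0
  then have "continuous (at x) f" if "x \<in> S" for x
    using that by (auto intro: differentiable_imp_continuous_within)
  then show ?case
    by (simp add: continuous_at_imp_continuous_on)
next
  case (Suc k)
  then show ?case
    by (metis Ck_on.simps(2))
qed

lemma Ck_on_subset:
  assumes "Ck_on k S f" "T \<subseteq> S"
  shows "Ck_on k T f"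
  using assms(1)
  by (induction k arbitrary: f) (use assms(2) in \<open>auto intro: continuous_on_subset\<close>)

lemma Ck_on_add:
  assumes "open S" "Ck_on k S f" "Ck_on k S g"
  shows "Ck_on k S (\<lambda>x. f x + g x)"
  using assms(2,3)
proof (induction k arbitrary: f g)
  case 0
  then show ?case by (auto intro: continuous_on_add)
next
  case (Suc k)
  show ?case
  proof (rule Ck_on_SucI[OF assms(1)])
    show "((\<lambda>x. f x + g x) has_derivative
        (\<lambda>v. frechet_derivative f (at x) v + frechet_derivative g (at x) v)) (at x)"
      if "x \<in> S" for x
      by (intro has_derivative_add Ck_on_SucD[OF Suc.prems(1) that] Ck_on_SucD[OF Suc.prems(2) that])
    show "Ck_on k S (\<lambda>x. frechet_derivative f (at x) v + frechet_derivative g (at x) v)" for v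
      using Suc by simp
  qed
qed

lemma Ck_on_bounded_linear:
  assumes "open S" "bounded_linear L" "Ck_on k S f"
  shows "Ck_on k S (\<lambda>x. L (f x))"
  using assms(3)
proof (induction k arbitrary: f)
  case 0
  then show ?case
    using bounded_linear.continuous_on[OF assms(2)] by auto
next
  case (Suc k)
  show ?case
    by (rule Ck_on_SucI[OF assms(1)])
      (use Suc in \<open>auto intro!: bounded_linear.has_derivative[OF assms(2)] Ck_on_SucD[OF Suc.prems]\<close>)
qed

text \<open>By the Leibniz rule the derivative of a product is a sum of products with one factor
  differentiated, so that one derivative of each factor is used up at a time.\<close>

lemma Ck_on_bilinear:
  assumes "open S" "bounded_bilinear B" "Ck_on k S f" "Ck_on k S g"
  shows "Ck_on k S (\<lambda>x. B (f x) (g x))"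
  using assms(3,4)
proof (induction k arbitrary: f g)
  case 0
  then show ?case
    using bounded_bilinear.continuous_on[OF assms(2)] by auto
next
  case (Suc k)
  show ?case
  proof (rule Ck_on_SucI[OF assms(1)])
    show "((\<lambda>x. B (f x) (g x)) has_derivative
        (\<lambda>v. B (f x) (frechet_derivative g (at x) v) + B (frechet_derivative f (at x) v) (g x))) (at x)"
      if "x \<in> S" for x
      by (intro bounded_bilinear.FDERIV[OF assms(2)] Ck_on_SucD[OF Suc.prems(1) that]
          Ck_on_SucD[OF Suc.prems(2) that])
    show "Ck_on k S (\<lambda>x. B (f x) (frechet_derivative g (at x) v) + B (frechet_derivative f (at x) v) (g x))"
      for v
      using Suc Ck_on_antimono_Suc[OF Suc.prems(1)] Ck_on_antimono_Suc[OF Suc.prems(2)]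
      by (intro Ck_on_add assms(1) Suc.IH) auto
  qed
qed

lemma smooth_on_transform:
  assumes "open S" "smooth_on S f" "\<And>x. x \<in> S \<Longrightarrow> f x = g x"
  shows "smooth_on S g"
  using Ck_on_cong[of S f g] assms unfolding smooth_on_def by blast

lemma smooth_on_subset: "smooth_on S f \<Longrightarrow> T \<subseteq> S \<Longrightarrow> smooth_on T f"
  unfolding smooth_on_def by (blast intro: Ck_on_subset)

lemma smooth_on_bounded_linear:
  assumes "open S" "bounded_linear L" "smooth_on S f"
  shows "smooth_on S (\<lambda>x. L (f x))"
  using assms Ck_on_bounded_linear unfolding smooth_on_def by blast

lemma smooth_on_bilinear:
  assumes "open S" "bounded_bilinear B" "smooth_on S f" "smooth_on S g"
  shows "smooth_on S (\<lambda>x. B (f x) (g x))"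
  using assms Ck_on_bilinear unfolding smooth_on_def by blast

lemma smooth_on_imp_continuous_on: "smooth_on S f \<Longrightarrow> continuous_on S f"
  unfolding smooth_on_def by (metis Ck_on.simps(1))

text \<open>In one variable the derivative in the direction \<open>v\<close> is \<open>v\<close> times the velocity, so only the
  velocity has to be checked.\<close>

lemma Ck_on_Suc_velocityI:
  fixes f :: "real \<Rightarrow> 'b::real_normed_vector"
  assumes "open S" "\<And>t. t \<in> S \<Longrightarrow> (f has_vector_derivative f' t) (at t)" "Ck_on k S f'"
  shows "Ck_on (Suc k) S f"
proof (rule Ck_on_SucI[OF assms(1)])
  show "(f has_derivative (\<lambda>v. v *\<^sub>R f' t)) (at t)" if "t \<in> S" for t
    using assms(2)[OF that] by (simp add: has_vector_derivative_def)
  show "Ck_on k S (\<lambda>t. v *\<^sub>R f' t)" for v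
    by (rule Ck_on_bounded_linear[OF assms(1) bounded_linear_scaleR_right assms(3)])
qed

lemma smooth_on_velocityI:
  fixes f :: "real \<Rightarrow> 'b::real_normed_vector"
  assumes "open S" "\<And>t. t \<in> S \<Longrightarrow> (f has_vector_derivative f' t) (at t)" "smooth_on S f'"
  shows "smooth_on S f"
  unfolding smooth_on_def
  using Ck_on_Suc_velocityI[OF assms(1,2)] assms(3) Ck_on_antimono_Suc unfolding smooth_on_def
  by blast

lemma smooth_on_has_vector_derivative:
  fixes f :: "real \<Rightarrow> 'b::real_normed_vector"
  assumes "smooth_on S f" "t \<in> S"
  shows "(f has_vector_derivative vector_derivative f (at t)) (at t)"
proof -
  have "Ck_on (Suc 0) S f"
    using assms(1) unfolding smooth_on_def by blast
  then show ?thesis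
    using assms(2) vector_derivative_works by fastforce
qed

lemma smooth_on_velocity:
  fixes f :: "real \<Rightarrow> 'b::real_normed_vector"
  assumes "open S" "smooth_on S f"
  shows "smooth_on S (\<lambda>t. vector_derivative f (at t))"
proof -
  have "frechet_derivative f (at t) 1 = vector_derivative f (at t)" if "t \<in> S" for t
    using smooth_on_has_vector_derivative[OF assms(2) that]
    by (simp add: has_vector_derivative_def flip: frechet_derivative_at)
  moreover have "smooth_on S (\<lambda>t. frechet_derivative f (at t) 1)"
    using assms(2) unfolding smooth_on_def by (metis Ck_on.simps(2))
  ultimately show ?thesis
    by (rule smooth_on_transform[OF assms(1), rotated])
qed

text \<open>The function \<open>h = 1 / \<bar>w\<bar>\<close> solves \<open>h' = - h\<^sup>3 \<langle>w, w'\<rangle>\<close>, so \<open>h'\<close> has as many derivatives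
  as \<open>h\<close>, and \<open>h\<close> has one more.\<close>

lemma smooth_on_inverse_norm:
  fixes w :: "real \<Rightarrow> 'b::real_inner"
  assumes "open S" "smooth_on S w" "\<And>t. t \<in> S \<Longrightarrow> w t \<noteq> 0"
  shows "smooth_on S (\<lambda>t. inverse (norm (w t)))"
proof -
  define h where "h t = inverse (norm (w t))" for t
  define p where "p t = w t \<bullet> vector_derivative w (at t)" for t
  have p: "smooth_on S p"
    unfolding p_def
    by (intro smooth_on_bilinear[OF assms(1) bounded_bilinear_inner] smooth_on_velocity assms)
  have h': "(h has_vector_derivative - (h t * (h t * h t) * p t)) (at t)" if "t \<in> S" for t
  proof -
    have "(w has_derivative (\<lambda>v. v *\<^sub>R vector_derivative w (at t))) (at t)"
      using smooth_on_has_vector_derivative[OF assms(2) that] by (simp add: has_vector_derivative_def)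
    then have "((\<lambda>t. norm (w t)) has_derivative
        (\<lambda>v. (v *\<^sub>R vector_derivative w (at t)) \<bullet> sgn (w t))) (at t)"
      by (rule has_derivative_compose[where f = w and g = norm, OF _ has_derivative_norm[OF assms(3)[OF that]]])
    then have "(h has_derivative (\<lambda>v. - (inverse (norm (w t)) *
        ((v *\<^sub>R vector_derivative w (at t)) \<bullet> sgn (w t)) * inverse (norm (w t))))) (at t)"
      unfolding h_def by (rule Deriv.has_derivative_inverse[where f = "\<lambda>t. norm (w t)", rotated]) (use assms(3)[OF that] in simp)
    moreover have "- (inverse (norm (w t)) * ((v *\<^sub>R vector_derivative w (at t)) \<bullet> sgn (w t)) *
        inverse (norm (w t))) = v *\<^sub>R - (h t * (h t * h t) * p t)" for v
      unfolding h_def p_def sgn_div_norm inner_scaleR_left inner_scaleR_right real_scaleR_def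
        inner_commute[of "w t"] by algebra
    ultimately show ?thesis
      unfolding has_vector_derivative_def by (simp only:)
  qed
  have "Ck_on k S h" for k
  proof (induction k)
    case 0
    show ?case
      using h' has_vector_derivative_continuous by (fastforce intro: continuous_at_imp_continuous_on)
  next
    case (Suc k)
    have "Ck_on k S p"
      using p by (simp add: smooth_on_def)
    then have "Ck_on k S (\<lambda>t. h t * (h t * h t) * p t)"
      using Suc by (intro Ck_on_bilinear[OF assms(1) bounded_bilinear_mult]) auto
    then have "Ck_on k S (\<lambda>t. - (h t * (h t * h t) * p t))"
      by (rule Ck_on_bounded_linear[OF assms(1) bounded_linear_minus[OF bounded_linear_ident]])
    then show ?case
      by (rule Ck_on_Suc_velocityI[OF assms(1), rotated]) (rule h')
  qed
  then show ?thesis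
    unfolding smooth_on_def h_def by blast
qed

text \<open>A change of parameter that solves a smooth autonomous equation \<open>\<tau>' = h(\<tau>)\<close> preserves
  smoothness: the velocity \<open>(h f') \<circ> \<tau>\<close> of \<open>f \<circ> \<tau>\<close> is again of this form.  The inverse of
  arclength is such a change of parameter, with \<open>h\<close> the inverse of the speed.\<close>

lemma smooth_on_reparametrization:
  fixes f :: "real \<Rightarrow> 'b::real_normed_vector" and \<tau> h :: "real \<Rightarrow> real"
  assumes "open I" "open J" "\<tau> ` I \<subseteq> J"
    and \<tau>: "\<And>s. s \<in> I \<Longrightarrow> (\<tau> has_vector_derivative h (\<tau> s)) (at s)"
    and "smooth_on J h" "smooth_on J f"
  shows "smooth_on I (\<lambda>s. f (\<tau> s))"
proof -
  have "Ck_on k I (\<lambda>s. f (\<tau> s))" if "smooth_on J f" for k and f :: "real \<Rightarrow> 'b"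
    using that
  proof (induction k arbitrary: f)
    case 0
    have "continuous_on I \<tau>"
      using \<tau> has_vector_derivative_continuous by (blast intro: continuous_at_imp_continuous_on)
    then show ?case
      using smooth_on_imp_continuous_on[OF 0] assms(3)
      by (auto intro: continuous_on_compose2)
  next
    case (Suc k)
    show ?case
    proof (rule Ck_on_Suc_velocityI[OF assms(1)])
      show "((\<lambda>s. f (\<tau> s)) has_vector_derivative
          h (\<tau> s) *\<^sub>R vector_derivative f (at (\<tau> s))) (at s)" if "s \<in> I" for s
        using vector_diff_chain_at[OF \<tau>[OF that] smooth_on_has_vector_derivative[OF Suc.prems]]
          assms(3) that by (auto simp: o_def)
      show "Ck_on k I (\<lambda>s. h (\<tau> s) *\<^sub>R vector_derivative f (at (\<tau> s)))"
        by (rule Suc.IH[of "\<lambda>t. h t *\<^sub>R vector_derivative f (at t)"])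
          (intro smooth_on_bilinear[OF assms(2) bounded_bilinear_scaleR] assms
            smooth_on_velocity Suc.prems)
    qed
  qed
  then show ?thesis
    using assms(6) unfolding smooth_on_def by blast
qed

lemma open_coordinatewise:
  assumes "\<And>j. open (I j)"
  shows "open {s :: real^'n::finite. \<forall>j. s $ j \<in> I j}"
proof -
  have "{s :: real^'n. \<forall>j. s $ j \<in> I j} = (\<Inter>j. (\<lambda>s. s $ j) -` I j)"
    by auto
  then show ?thesis
    using assms by (auto intro!: open_INT open_vimage continuous_intros)
qed

lemma has_derivative_coordinatewise:
  fixes f :: "'n::finite \<Rightarrow> real \<Rightarrow> 'b::euclidean_space"
  assumes "\<And>j. (f j has_vector_derivative f' j) (at (s $ j))"
  shows "((\<lambda>s. \<chi> j. f j (s $ j)) has_derivative (\<lambda>v. \<chi> j. v $ j *\<^sub>R f' j)) (at s)"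
proof -
  have "((\<lambda>s. f j (s $ j)) has_derivative (\<lambda>v. v $ j *\<^sub>R f' j)) (at s)" for j
    using assms[of j] unfolding has_vector_derivative_def
    by (rule has_derivative_compose[OF bounded_linear_imp_has_derivative[OF bounded_linear_vec_nth]])
  then have "((\<lambda>s. f j (s $ j) \<bullet> b) has_derivative (\<lambda>v. (v $ j *\<^sub>R f' j) \<bullet> b)) (at s)" for j b
    by (rule has_derivative_inner_left)
  then show ?thesis
    by (subst has_derivative_componentwise_within) (auto simp: Basis_vec_def inner_axis)
qed

lemma smooth_on_coordinatewise:
  fixes f :: "'n::finite \<Rightarrow> real \<Rightarrow> 'b::euclidean_space"
  assumes I: "\<And>j. open (I j)" and f: "\<And>j. smooth_on (I j) (f j)"
  shows "smooth_on {s. \<forall>j. s $ j \<in> I j} (\<lambda>s. \<chi> j. f j (s $ j))"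
proof -
  have "Ck_on k {s. \<forall>j. s $ j \<in> I j} (\<lambda>s. \<chi> j. f j (s $ j))"
    if "\<And>j. smooth_on (I j) (f j)" for k and f :: "'n \<Rightarrow> real \<Rightarrow> 'b"
    using that
  proof (induction k arbitrary: f)
    case 0
    have "continuous_on (I j) (f j)" for j
      using smooth_on_imp_continuous_on[OF 0] .
    then have "continuous_on {s. \<forall>j. s $ j \<in> I j} (\<lambda>s. f i (s $ i))" for i
      by (rule continuous_on_compose2) (auto intro: continuous_intros)
    then show ?case
      by (auto intro: continuous_on_vec_lambda)
  next
    case (Suc k)
    show ?case
    proof (rule Ck_on_SucI[OF open_coordinatewise[OF I]])
      show "((\<lambda>s. \<chi> j. f j (s $ j)) has_derivative
          (\<lambda>v. \<chi> j. v $ j *\<^sub>R vector_derivative (f j) (at (s $ j)))) (at s)"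
        if "s \<in> {s. \<forall>j. s $ j \<in> I j}" for s
        using that by (intro has_derivative_coordinatewise smooth_on_has_vector_derivative[OF Suc.prems]) auto
      show "Ck_on k {s. \<forall>j. s $ j \<in> I j}
          (\<lambda>s. \<chi> j. v $ j *\<^sub>R vector_derivative (f j) (at (s $ j)))" for v :: "real^'n"
        by (rule Suc.IH[of "\<lambda>j t. v $ j *\<^sub>R vector_derivative (f j) (at t)"])
          (intro smooth_on_bounded_linear[OF I bounded_linear_scaleR_right]
            smooth_on_velocity I Suc.prems)
    qed
  qed
  then show ?thesis
    using f unfolding smooth_on_def by blast
qed

section \<open>Unit speed curves and their angle function\<close>

locale unit_speed_curve =
  fixes I :: "real set" and \<alpha> :: "real \<Rightarrow> complex"
  assumes open_domain: "open I"
    and smooth: "smooth_on I \<alpha>"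
    and unit_speed: "s \<in> I \<Longrightarrow> cmod (velocity \<alpha> s) = 1"

text \<open>Arclength \<open>\<sigma>\<close> has positive derivative \<open>\<bar>\<gamma>'\<bar>\<close>, so it is a diffeomorphism onto its open image,
  and its inverse \<open>\<tau>\<close> satisfies \<open>\<tau>' = (1 / \<bar>\<gamma>'\<bar>) \<circ> \<tau>\<close>.\<close>

lemma arclength_parametrization_unit_speed:
  assumes "regular_curve J \<gamma>" "arclength_parametrization J \<gamma> I \<alpha>"
  shows "unit_speed_curve I \<alpha>"
proof -
  have J: "open J" "is_interval J" and \<gamma>: "smooth_on J \<gamma>" and nz: "\<And>t. t \<in> J \<Longrightarrow> velocity \<gamma> t \<noteq> 0"
    using assms(1) by (auto simp: regular_curve_def)
  obtain \<sigma> where \<sigma>: "\<And>a b. a \<in> J \<Longrightarrow> b \<in> J \<Longrightarrow> a \<le> b \<Longrightarrow>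
        ((\<lambda>t. cmod (velocity \<gamma> t)) has_integral (\<sigma> b - \<sigma> a)) {a..b}"
      and I: "I = \<sigma> ` J" and \<alpha>: "\<And>t. t \<in> J \<Longrightarrow> \<alpha> (\<sigma> t) = \<gamma> t"
    using assms(2) unfolding arclength_parametrization_def by blast
  have vel: "smooth_on J (velocity \<gamma>)"
    using smooth_on_velocity[OF J(1) \<gamma>] .
  have sub: "{a..b} \<subseteq> J" if "a \<in> J" "b \<in> J" for a b
    using J(2) that unfolding is_interval_1 by (meson atLeastAtMost_iff subsetI)
  have \<sigma>': "(\<sigma> has_real_derivative cmod (velocity \<gamma> t)) (at t)" if t: "t \<in> J" for t
  proof -
    obtain e where e: "e > 0" "cball t e \<subseteq> J"
      using J(1) t open_contains_cball by blast
    then have ab: "t - e \<in> J" "t + e \<in> J"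
      using subsetD[OF e(2), of "t - e"] subsetD[OF e(2), of "t + e"] by (simp_all add: dist_real_def)
    have cont: "continuous_on {t - e..t + e} (\<lambda>t. cmod (velocity \<gamma> t))"
      using continuous_on_subset[OF smooth_on_imp_continuous_on[OF vel] sub[OF ab]]
      by (intro continuous_on_norm)
    have "((\<lambda>u. integral {t - e..u} (\<lambda>t. cmod (velocity \<gamma> t))) has_real_derivative
        cmod (velocity \<gamma> t)) (at t within {t - e..t + e})"
      using integral_has_real_derivative[OF cont, of t] e(1) by simp
    then have "((\<lambda>u. integral {t - e..u} (\<lambda>t. cmod (velocity \<gamma> t)) + \<sigma> (t - e)) has_real_derivative
        cmod (velocity \<gamma> t)) (at t)"
      using e(1) by (auto intro!: derivative_eq_intros simp: at_within_Icc_at)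
    then show ?thesis
    proof (rule has_field_derivative_transform_within_open[of _ _ _ "{t - e<..<t + e}"])
      show "integral {t - e..u} (\<lambda>t. cmod (velocity \<gamma> t)) + \<sigma> (t - e) = \<sigma> u"
        if "u \<in> {t - e<..<t + e}" for u
      proof -
        have "u \<in> J"
          using sub[OF ab] that by auto
        then show ?thesis
          using integral_unique[OF \<sigma>[of "t - e" u]] ab that by simp
      qed
    qed (use e(1) in auto)
  qed
  have less: "\<sigma> a < \<sigma> b" if "a \<in> J" "b \<in> J" "a < b" for a b
    using that(3)
  proof (rule DERIV_pos_imp_increasing)
    fix x assume "a \<le> x" "x \<le> b"
    then have "x \<in> J" using sub[OF that(1,2)] by auto
    then show "\<exists>y. DERIV \<sigma> x :> y \<and> y > 0"
      using \<sigma>' nz by (intro exI[of _ "cmod (velocity \<gamma> x)"]) auto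
  qed
  have inj: "inj_on \<sigma> J"
    by (rule inj_onI) (metis less less_irrefl linorder_less_linear)
  have cont: "continuous_on J \<sigma>"
    using \<sigma>' DERIV_isCont by (blast intro: continuous_at_imp_continuous_on)
  define \<tau> where "\<tau> = inv_into J \<sigma>"
  have \<tau>\<sigma>: "\<tau> (\<sigma> t) = t" if "t \<in> J" for t
    using inj that by (simp add: \<tau>_def)
  have openI: "open I"
    unfolding I by (rule invariance_of_domain[OF cont J(1) inj])
  have \<tau>J: "\<tau> ` I \<subseteq> J"
    using \<tau>\<sigma> I by auto
  have \<tau>': "(\<tau> has_vector_derivative inverse (cmod (velocity \<gamma> (\<tau> s)))) (at s)" if "s \<in> I" for s
  proof -
    obtain t where t: "t \<in> J" "s = \<sigma> t"
      using \<open>s \<in> I\<close> I by blast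
    have "(\<tau> has_derivative (\<lambda>v. v * inverse (cmod (velocity \<gamma> t)))) (at (\<sigma> t))"
    proof (rule has_derivative_inverse_strong[OF J(1) t(1) cont \<tau>\<sigma>])
      show "(\<sigma> has_derivative (\<lambda>v. v * cmod (velocity \<gamma> t))) (at t)"
        using \<sigma>'[OF t(1)] by (simp add: has_field_derivative_def mult_commute_abs)
      show "(\<lambda>v. v * cmod (velocity \<gamma> t)) \<circ> (\<lambda>v. v * inverse (cmod (velocity \<gamma> t))) = id"
        using nz[OF t(1)] by (simp add: fun_eq_iff)
    qed
    then show ?thesis
      using t \<tau>\<sigma> by (simp add: has_vector_derivative_def)
  qed
  have \<alpha>\<tau>: "\<alpha> s = \<gamma> (\<tau> s)" if "s \<in> I" for s
    using that I \<alpha> \<tau>\<sigma> by auto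
  have "smooth_on I (\<lambda>s. \<gamma> (\<tau> s))"
    using smooth_on_reparametrization[OF openI J(1) \<tau>J \<tau>' smooth_on_inverse_norm[OF J(1) vel nz] \<gamma>] .
  then have sm: "smooth_on I \<alpha>"
    by (rule smooth_on_transform[OF openI]) (simp add: \<alpha>\<tau>)
  have "cmod (velocity \<alpha> s) = 1" if s: "s \<in> I" for s
  proof -
    have ts: "\<tau> s \<in> J"
      using \<tau>J s by auto
    have "((\<lambda>s. \<gamma> (\<tau> s)) has_vector_derivative
        inverse (cmod (velocity \<gamma> (\<tau> s))) *\<^sub>R velocity \<gamma> (\<tau> s)) (at s)"
      using vector_diff_chain_at[OF \<tau>'[OF s] smooth_on_has_vector_derivative[OF \<gamma> ts]]
      by (simp add: o_def)
    then have "(\<alpha> has_vector_derivative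
        inverse (cmod (velocity \<gamma> (\<tau> s))) *\<^sub>R velocity \<gamma> (\<tau> s)) (at s)"
      using \<alpha>\<tau> by (auto intro: has_vector_derivative_transform_within_open[OF _ openI s])
    then show ?thesis
      using nz[OF ts] by (simp add: vector_derivative_at)
  qed
  then show ?thesis
    by unfold_locales (use openI sm in auto)
qed

context unit_speed_curve
begin

lemma smooth_velocity: "smooth_on I (velocity \<alpha>)"
  by (rule smooth_on_velocity[OF open_domain smooth])

lemma signed_curvature_eq:
  "s \<in> I \<Longrightarrow> signed_curvature \<alpha> s = Im (cnj (velocity \<alpha> s) * velocity (velocity \<alpha>) s)"
  by (simp add: signed_curvature_def unit_speed)

lemma smooth_signed_curvature: "smooth_on I (signed_curvature \<alpha>)"
proof -
  have "smooth_on I (\<lambda>s. cnj (velocity \<alpha> s) * velocity (velocity \<alpha>) s)"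
    by (intro smooth_on_bilinear[OF open_domain bounded_bilinear_mult]
        smooth_on_bounded_linear[OF open_domain bounded_linear_cnj]
        smooth_on_velocity[OF open_domain] smooth_velocity smooth)
  then have "smooth_on I (\<lambda>s. Im (cnj (velocity \<alpha> s) * velocity (velocity \<alpha>) s))"
    by (rule smooth_on_bounded_linear[OF open_domain bounded_linear_Im])
  then show ?thesis
    by (rule smooth_on_transform[OF open_domain]) (simp add: signed_curvature_eq)
qed

lemma signed_curvature_has_derivative:
  assumes "s \<in> I"
  shows "(signed_curvature \<alpha> has_vector_derivative deriv (signed_curvature \<alpha>) s) (at s)"
  using smooth_on_has_vector_derivative[OF smooth_signed_curvature assms]
  by (metis DERIV_imp_deriv has_real_derivative_iff_has_vector_derivative)

text \<open>Near \<open>s\<^sub>0\<close> the velocity stays off the ray opposite to its value \<open>e\<^bsup>ia\<^esup>\<close> at \<open>s\<^sub>0\<close>, so that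
  \<open>\<theta> = a + Im (Ln (\<alpha>' e\<^bsup>-ia\<^esup>))\<close> is a smooth choice of angle.  Its derivative is
  \<open>Im (\<alpha>'' / \<alpha>')\<close>, which is the curvature because \<open>1 / \<alpha>' = cnj \<alpha>'\<close> at unit speed.\<close>

lemma local_angle_function:
  assumes "s\<^sub>0 \<in> I"
  obtains W \<theta> where "open W" "s\<^sub>0 \<in> W" "W \<subseteq> I" "smooth_on W \<theta>"
    "\<And>s. s \<in> W \<Longrightarrow> (\<theta> has_vector_derivative signed_curvature \<alpha> s) (at s)"
    "\<And>s. s \<in> W \<Longrightarrow> carg (velocity \<alpha> s) = angle_of (\<theta> s)"
proof -
  define a where "a = Arg (velocity \<alpha> s\<^sub>0)"
  define w where "w s = velocity \<alpha> s * cis (- a)" for s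
  define \<theta> where "\<theta> s = a + Im (Ln (w s))" for s
  define W where "W = I \<inter> w -` (- \<real>\<^sub>\<le>\<^sub>0)"
  have norm_w: "cmod (w s) = 1" if "s \<in> I" for s
    using unit_speed[OF that] by (simp add: w_def norm_mult)
  have w: "velocity \<alpha> s = w s * cis a" for s
    by (simp add: w_def cis_mult mult.assoc)
  have cont: "continuous_on I w"
    unfolding w_def using smooth_on_imp_continuous_on[OF smooth_velocity]
    by (intro continuous_intros)
  have openW: "open W"
    unfolding W_def using open_domain cont by (intro continuous_open_preimage) auto
  have "velocity \<alpha> s\<^sub>0 \<noteq> 0"
    using unit_speed[OF assms] by auto
  then have "velocity \<alpha> s\<^sub>0 = cis a"
    using unit_speed[OF assms] cis_Arg[of "velocity \<alpha> s\<^sub>0"] by (simp add: a_def sgn_eq)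
  then have "w s\<^sub>0 = 1"
    by (simp add: w_def cis_mult)
  then have s0: "s\<^sub>0 \<in> W"
    using assms by (simp add: W_def complex_nonpos_Reals_iff)
  have deriv: "(\<theta> has_vector_derivative signed_curvature \<alpha> s) (at s)" if s: "s \<in> W" for s
  proof -
    have sI: "s \<in> I" and slit: "w s \<notin> \<real>\<^sub>\<le>\<^sub>0"
      using s by (auto simp: W_def)
    define A where "A = velocity (velocity \<alpha>) s"
    have "(velocity \<alpha> has_vector_derivative A) (at s)"
      unfolding A_def by (rule smooth_on_has_vector_derivative[OF smooth_velocity sI])
    then have "(w has_vector_derivative A * cis (- a)) (at s)"
      unfolding w_def by (rule has_vector_derivative_mult_left)
    then have "((\<lambda>s. Ln (w s)) has_vector_derivative A * cis (- a) * inverse (w s)) (at s)"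
      using field_vector_diff_chain_at[where f = w, OF _ has_field_derivative_Ln[OF slit]]
      by (simp add: o_def)
    then have "((\<lambda>s. Im (Ln (w s))) has_vector_derivative Im (A * cis (- a) * inverse (w s))) (at s)"
      by (rule bounded_linear.has_vector_derivative[OF bounded_linear_Im])
    then have \<theta>: "(\<theta> has_vector_derivative Im (A * cis (- a) * inverse (w s))) (at s)"
      unfolding \<theta>_def using has_vector_derivative_add[OF has_vector_derivative_const] by fastforce
    have "A * cis (- a) * inverse (w s) = A * inverse (velocity \<alpha> s)"
      using w[of s] by (simp add: w_def cis_mult mult.assoc flip: cis_inverse)
    also have "inverse (velocity \<alpha> s) = cnj (velocity \<alpha> s)"
      using unit_speed[OF sI] complex_norm_square[of "velocity \<alpha> s"]
      by (intro inverse_unique) simp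
    finally have "A * cis (- a) * inverse (w s) = cnj (velocity \<alpha> s) * velocity (velocity \<alpha>) s"
      by (simp add: A_def mult.commute)
    then show ?thesis
      using \<theta> signed_curvature_eq[OF sI] by simp
  qed
  have "smooth_on W \<theta>"
    by (rule smooth_on_velocityI[OF openW deriv])
      (auto simp: W_def intro: smooth_on_subset[OF smooth_signed_curvature])
  moreover have "carg (velocity \<alpha> s) = angle_of (\<theta> s)" if s: "s \<in> W" for s
  proof -
    have sI: "s \<in> I"
      using s by (auto simp: W_def)
    have w0: "w s \<noteq> 0"
      using norm_w[OF sI] by auto
    then have "Ln (w s) = \<i> * of_real (Im (Ln (w s)))"
      using norm_w[OF sI] by (simp add: complex_eq_iff)
    then have "w s = cis (Im (Ln (w s)))"
      using exp_Ln[OF w0] by (metis cis_conv_exp)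
    then have "velocity \<alpha> s = cis (\<theta> s)"
      unfolding w[of s] \<theta>_def by (metis cis_mult add.commute)
    then show ?thesis
      by (subst carg_eq_angle_of_iff) (auto simp: cis_conv_exp)
  qed
  ultimately show thesis
    using that[of W \<theta>] openW s0 deriv by (auto simp: W_def)
qed

end

section \<open>Metrics with constant coefficients\<close>

text \<open>A derivative only depends on the values near a point.  So wherever the Gram matrix is constant
  on an open set, the Christoffel symbols vanish there, and the covariant derivative is the
  componentwise one.\<close>

lemma has_derivative_locally_constant:
  assumes "open U" "x \<in> U" "\<And>y. y \<in> U \<Longrightarrow> f y = c"
  shows "(f has_derivative (\<lambda>_. 0)) (at x)"
  using has_derivative_transform_within_open[OF has_derivative_const assms(1,2), of c] assms(3)
  by simp

lemma levi_civita_constant_metric: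
  assumes "open U" "x \<in> U" "\<And>y. y \<in> U \<Longrightarrow> g y = c"
  shows "levi_civita g v Y x = frechet_derivative Y (at x) v"
proof -
  have "frechet_derivative g (at x) = (\<lambda>_. 0)"
    using frechet_derivative_at[OF has_derivative_locally_constant[OF assms]] by simp
  then show ?thesis
    by (simp add: levi_civita_def christoffel_def vec_eq_iff)
qed

lemma flat_constant_metric:
  assumes "open U" "\<And>y. y \<in> U \<Longrightarrow> g y = c"
  shows "flat_metric_on U g"
proof -
  have const: "levi_civita g v (\<lambda>_. w) y = 0" if "y \<in> U" for v w y
    using levi_civita_constant_metric[of U y g c] assms that by (simp add: frechet_derivative_const)
  have "levi_civita g u (levi_civita g v (\<lambda>_. w)) x = 0" if "x \<in> U" for u v w x
  proof -
    have "frechet_derivative (levi_civita g v (\<lambda>_. w)) (at x) = (\<lambda>_. 0)"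
      using frechet_derivative_at[OF has_derivative_locally_constant[OF assms(1) that const]] by simp
    then show ?thesis
      using levi_civita_constant_metric[OF assms(1) that assms(2)] by simp
  qed
  then show ?thesis
    by (simp add: flat_metric_on_def riemann_curvature_def)
qed

lemma matrix_inv_mat_1: "matrix_inv (mat 1 :: real^'n^'n) = mat 1"
  using matrix_inv_mul(1)[of "mat 1 :: real^'n^'n"] by (simp add: invertible_def)

section \<open>Sums of angles\<close>

lemma angle_of_add: "angle_of (x + y) = angle_of x + angle_of y"
  by (simp add: plus_angle.abs_eq)

lemma angle_of_sum: "angle_of (\<Sum>j\<in>A. f j) = (\<Sum>j\<in>A. angle_of (f j))"
  by (induction A rule: infinite_finite_induct) (simp_all add: angle_of_add flip: zero_angle_def)

lemma carg_mult:
  assumes "z \<noteq> 0" "w \<noteq> 0"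
  shows "carg (z * w) = carg z + carg w"
proof -
  have "cis (Arg (z * w)) = cis (Arg z + Arg w)"
    using assms by (simp add: cis_Arg sgn_mult flip: cis_mult)
  then show ?thesis
    by (simp add: carg_def angle_of_eq_iff_cis flip: angle_of_add)
qed

lemma carg_1: "carg 1 = 0"
  by (simp add: carg_def zero_angle_def)

lemma carg_prod: "(\<And>j. j \<in> A \<Longrightarrow> f j \<noteq> 0) \<Longrightarrow> carg (\<Prod>j\<in>A. f j) = (\<Sum>j\<in>A. carg (f j))"
  by (induction A rule: infinite_finite_induct) (auto simp: carg_1 carg_mult)

section \<open>Products of unit speed curves\<close>

locale unit_speed_product =
  fixes I :: "'n::finite \<Rightarrow> real set" and \<alpha> :: "'n \<Rightarrow> real \<Rightarrow> complex"
  assumes unit_speed_factor: "unit_speed_curve (I j) (\<alpha> j)"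
begin

sublocale factor: unit_speed_curve "I j" "\<alpha> j" for j
  by (rule unit_speed_factor)

definition U :: "(real^'n) set" where
  "U = {s. \<forall>j. s $ j \<in> I j}"

definition \<Phi> :: "real^'n \<Rightarrow> complex^'n" where
  "\<Phi> s = (\<chi> j. \<alpha> j (s $ j))"

lemma open_U: "open U"
  unfolding U_def by (rule open_coordinatewise[OF factor.open_domain])

lemma frechet_derivative_\<Phi>:
  assumes "s \<in> U"
  shows "frechet_derivative \<Phi> (at s) = (\<lambda>v. \<chi> j. v $ j *\<^sub>R velocity (\<alpha> j) (s $ j))"
proof -
  have "(\<Phi> has_derivative (\<lambda>v. \<chi> j. v $ j *\<^sub>R velocity (\<alpha> j) (s $ j))) (at s)"
    unfolding \<Phi>_def
    using assms factor.smooth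
    by (intro has_derivative_coordinatewise smooth_on_has_vector_derivative) (auto simp: U_def)
  then show ?thesis
    by (rule frechet_derivative_at[symmetric])
qed

lemma velocity_norm:
  assumes "s \<in> U"
  shows "cmod (velocity (\<alpha> j) (s $ j)) = 1"
  using assms by (intro factor.unit_speed) (simp add: U_def)

lemma velocity_nonzero:
  assumes "s \<in> U"
  shows "velocity (\<alpha> j) (s $ j) \<noteq> 0"
  using velocity_norm[OF assms, of j] by auto

text \<open>The \<open>j\<close>-th component of the differential takes its values in the real line spanned by \<open>\<alpha>\<^sub>j'\<close>,
  and every real line in \<open>\<complex>\<close> is Lagrangian.\<close>

lemma lagrangian_immersion: "lagrangian_immersion_on U \<Phi>"
  unfolding lagrangian_immersion_on_def immersion_on_def
proof (intro conjI ballI allI)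
  show "open U" by (rule open_U)
  show "smooth_on U \<Phi>"
    unfolding U_def \<Phi>_def
    by (rule smooth_on_coordinatewise[OF factor.open_domain factor.smooth])
  show "inj (frechet_derivative \<Phi> (at s))" if "s \<in> U" for s
    using velocity_nonzero[OF that] by (auto simp: frechet_derivative_\<Phi>[OF that] inj_def vec_eq_iff)
  show "kaehler_form (frechet_derivative \<Phi> (at s) u) (frechet_derivative \<Phi> (at s) v) = 0"
    if "s \<in> U" for s u v
    by (simp add: frechet_derivative_\<Phi>[OF that] kaehler_form_def)
qed

text \<open>The differential sends the coordinate frame to the unit vectors \<open>\<alpha>\<^sub>j'\<close>, which lie in different
  complex coordinate lines and are therefore orthonormal.\<close>

lemma induced_metric_\<Phi>:
  assumes "s \<in> U"
  shows "induced_metric \<Phi> s = mat 1"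
proof -
  have "frechet_derivative \<Phi> (at s) (axis i 1) \<bullet> frechet_derivative \<Phi> (at s) (axis j 1) =
      (if i = j then 1 else 0)" for i j
  proof -
    have "frechet_derivative \<Phi> (at s) (axis k 1) = axis k (velocity (\<alpha> k) (s $ k))" for k
      by (simp add: frechet_derivative_\<Phi>[OF assms] axis_def vec_eq_iff)
    then show ?thesis
      using velocity_norm[OF assms] by (simp add: inner_axis_axis dot_square_norm)
  qed
  then show ?thesis
    by (simp add: induced_metric_def mat_def)
qed

text \<open>The differential is the diagonal matrix of the velocities, so its complex determinant is
  their product.\<close>

lemma lagrangian_angle_\<Phi>:
  assumes "s \<in> U"
  shows "lagrangian_angle \<Phi> s = (\<Sum>j\<in>UNIV. carg (velocity (\<alpha> j) (s $ j)))"
proof -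
  have "dz_volume (\<lambda>k. frechet_derivative \<Phi> (at s) (axis k 1)) = (\<Prod>j\<in>UNIV. velocity (\<alpha> j) (s $ j))"
    unfolding dz_volume_def
    by (subst det_diagonal) (simp_all add: frechet_derivative_\<Phi>[OF assms] axis_def)
  then show ?thesis
    using velocity_nonzero[OF assms] by (simp add: lagrangian_angle_def carg_prod)
qed

text \<open>Summing local angle functions of the factors gives a local lift of the Lagrangian angle whose
  partial derivatives are the curvatures.\<close>

lemma angle_gradient_\<Phi>:
  assumes "s \<in> U"
  shows "angle_gradient (induced_metric \<Phi>) (lagrangian_angle \<Phi>) s =
    (\<chi> j. signed_curvature (\<alpha> j) (s $ j))"
proof -
  have "\<exists>W \<theta>. open W \<and> s $ j \<in> W \<and> W \<subseteq> I j \<and> smooth_on W \<theta> \<and>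
      (\<forall>t\<in>W. (\<theta> has_vector_derivative signed_curvature (\<alpha> j) t) (at t)) \<and>
      (\<forall>t\<in>W. carg (velocity (\<alpha> j) t) = angle_of (\<theta> t))" for j
  proof -
    have "s $ j \<in> I j"
      using assms by (simp add: U_def)
    then obtain W \<theta> where "open W" "s $ j \<in> W" "W \<subseteq> I j" "smooth_on W \<theta>"
        "\<And>t. t \<in> W \<Longrightarrow> (\<theta> has_vector_derivative signed_curvature (\<alpha> j) t) (at t)"
        "\<And>t. t \<in> W \<Longrightarrow> carg (velocity (\<alpha> j) t) = angle_of (\<theta> t)"
      using factor.local_angle_function by blast
    then show ?thesis
      by blast
  qed
  then obtain W \<theta> where W: "\<And>j. open (W j)" "\<And>j. s $ j \<in> W j" "\<And>j. W j \<subseteq> I j"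
      and \<theta>: "\<And>j. smooth_on (W j) (\<theta> j)"
        "\<And>j t. t \<in> W j \<Longrightarrow> (\<theta> j has_vector_derivative signed_curvature (\<alpha> j) t) (at t)"
        "\<And>j t. t \<in> W j \<Longrightarrow> carg (velocity (\<alpha> j) t) = angle_of (\<theta> j t)"
    by metis
  \<comment> \<open>The detour over the vector of the angle functions makes \<open>h\<close> a linear image of a coordinatewise
    map, so that its smoothness and its derivative are instances of the general facts.\<close>
  define h where "h = (\<lambda>x :: real^'n. \<Sum>j\<in>UNIV. (\<chi> j. \<theta> j (x $ j)) $ j)"
  define V where "V = {x :: real^'n. \<forall>j. x $ j \<in> W j}"
  have lin: "bounded_linear (\<lambda>x :: real^'n. \<Sum>j\<in>UNIV. x $ j)"
    by (intro bounded_linear_sum bounded_linear_vec_nth)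
  have "local_lift (lagrangian_angle \<Phi>) h s"
    unfolding local_lift_def
  proof (intro exI conjI ballI)
    show V: "open V"
      unfolding V_def by (rule open_coordinatewise[OF W(1)])
    show "s \<in> V"
      using W(2) by (simp add: V_def)
    show "smooth_on V h"
      unfolding h_def using V unfolding V_def
      by (intro smooth_on_bounded_linear[OF _ lin] smooth_on_coordinatewise W(1) \<theta>(1))
    show "lagrangian_angle \<Phi> x = angle_of (h x)" if "x \<in> V" for x
    proof -
      have "x \<in> U"
        using that W(3) by (auto simp: U_def V_def)
      then show ?thesis
        using that \<theta>(3) by (simp add: lagrangian_angle_\<Phi> h_def angle_of_sum V_def)
    qed
  qed
  then have "angle_gradient (induced_metric \<Phi>) (lagrangian_angle \<Phi>) s = gradient (induced_metric \<Phi>) h s"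
    by (rule angle_gradient_eq)
  also have "\<dots> = (\<chi> i. frechet_derivative h (at s) (axis i 1))"
    by (simp add: gradient_def induced_metric_\<Phi>[OF assms] matrix_inv_mat_1)
  also have "frechet_derivative h (at s) =
      (\<lambda>v. \<Sum>j\<in>UNIV. (\<chi> j. v $ j *\<^sub>R signed_curvature (\<alpha> j) (s $ j)) $ j)"
    unfolding h_def
    using W(2) \<theta>(2)
    by (intro frechet_derivative_at[symmetric] bounded_linear.has_derivative[OF lin]
        has_derivative_coordinatewise) auto
  finally show ?thesis
    by (simp add: axis_def vec_eq_iff if_distrib[where f = "\<lambda>x. x * _"] cong: if_cong)
qed

text \<open>The \<open>j\<close>-th component \<open>\<kappa>\<^sub>j(s\<^sub>j)\<close> of the gradient depends on the single coordinate \<open>s\<^sub>j\<close>, so its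
  Hessian is diagonal with entries \<open>\<kappa>\<^sub>j'\<close>; both formulas for the derivatives of the angle are
  contained in this one.\<close>

lemma levi_civita_angle_gradient:
  assumes "s \<in> U"
  shows "levi_civita (induced_metric \<Phi>) v (angle_gradient (induced_metric \<Phi>) (lagrangian_angle \<Phi>)) s =
    (\<chi> j. v $ j * deriv (signed_curvature (\<alpha> j)) (s $ j))"
proof -
  have "((\<lambda>s. \<chi> j. signed_curvature (\<alpha> j) (s $ j)) has_derivative
      (\<lambda>v. \<chi> j. v $ j *\<^sub>R deriv (signed_curvature (\<alpha> j)) (s $ j))) (at s)"
    using assms
    by (intro has_derivative_coordinatewise factor.signed_curvature_has_derivative) (auto simp: U_def)
  then have "(angle_gradient (induced_metric \<Phi>) (lagrangian_angle \<Phi>) has_derivative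
      (\<lambda>v. \<chi> j. v $ j *\<^sub>R deriv (signed_curvature (\<alpha> j)) (s $ j))) (at s)"
    by (rule has_derivative_transform_within_open[OF _ open_U assms]) (simp add: angle_gradient_\<Phi>)
  then show ?thesis
    using levi_civita_constant_metric[OF open_U assms induced_metric_\<Phi>]
    by (simp flip: frechet_derivative_at)
qed

end

theorem proposition1:
  fixes \<gamma> \<alpha> :: "'n::finite \<Rightarrow> real \<Rightarrow> complex"
    and J I :: "'n \<Rightarrow> real set"
    and U :: "(real^'n) set"
    and \<Phi> :: "real^'n \<Rightarrow> complex^'n"
    and \<kappa> :: "'n \<Rightarrow> real \<Rightarrow> real"
  assumes regular: "\<And>j. regular_curve (J j) (\<gamma> j)"
    and arclength: "\<And>j. arclength_parametrization (J j) (\<gamma> j) (I j) (\<alpha> j)"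
    and curvature: "\<And>j. \<kappa> j = signed_curvature (\<alpha> j)"
    and domain: "U = {s. \<forall>j. s $ j \<in> I j}"
    and product: "\<Phi> = (\<lambda>s. \<chi> j. \<alpha> j (s $ j))"
  shows "lagrangian_immersion_on U \<Phi>
    \<and> flat_metric_on U (induced_metric \<Phi>)
    \<and> (\<forall>s\<in>U. lagrangian_angle \<Phi> s = (\<Sum>j\<in>UNIV. carg (velocity (\<alpha> j) (s $ j))))
    \<and> (\<forall>s\<in>U. \<forall>j. levi_civita (induced_metric \<Phi>) (axis j 1)
                        (angle_gradient (induced_metric \<Phi>) (lagrangian_angle \<Phi>)) s
                    = deriv (\<kappa> j) (s $ j) *\<^sub>R axis j 1)
    \<and> (\<forall>s\<in>U. angle_laplacian (induced_metric \<Phi>) (lagrangian_angle \<Phi>) s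
                    = (\<Sum>j\<in>UNIV. deriv (\<kappa> j) (s $ j)))"
proof -
  interpret P: unit_speed_product I \<alpha>
    by (rule unit_speed_product.intro) (rule arclength_parametrization_unit_speed[OF regular arclength])
  have U: "U = P.U" and \<Phi>: "\<Phi> = P.\<Phi>"
    by (simp_all add: domain product P.U_def P.\<Phi>_def fun_eq_iff)
  show ?thesis
    unfolding U \<Phi> curvature
  proof (intro conjI ballI allI)
    show "lagrangian_immersion_on P.U P.\<Phi>"
      by (rule P.lagrangian_immersion)
    show "flat_metric_on P.U (induced_metric P.\<Phi>)"
      by (rule flat_constant_metric[OF P.open_U P.induced_metric_\<Phi>])
    fix s assume s: "s \<in> P.U"
    show "lagrangian_angle P.\<Phi> s = (\<Sum>j\<in>UNIV. carg (velocity (\<alpha> j) (s $ j)))"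
      by (rule P.lagrangian_angle_\<Phi>[OF s])
    show "levi_civita (induced_metric P.\<Phi>) (axis j 1)
        (angle_gradient (induced_metric P.\<Phi>) (lagrangian_angle P.\<Phi>)) s =
      deriv (signed_curvature (\<alpha> j)) (s $ j) *\<^sub>R axis j 1" for j
      by (simp add: P.levi_civita_angle_gradient[OF s] vec_eq_iff axis_def)
    show "angle_laplacian (induced_metric P.\<Phi>) (lagrangian_angle P.\<Phi>) s =
      (\<Sum>j\<in>UNIV. deriv (signed_curvature (\<alpha> j)) (s $ j))"
      by (simp add: angle_laplacian_def divergence_def P.levi_civita_angle_gradient[OF s])
  qed
qed

end
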